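(* Let $M_1,\dots,M_d$ be matroids on the same finite ground set $E$. If there are subsets $V_1,\dots,V_d\subset E$ such that every element of $E$ belongs to exactly two of them (i.e. to $V_i$ for exactly two indices $i$) and $V_i$ is independent in $M_i$ for each $i$, then Alice has a winning strategy in the coloring game on $M_1,\dots,M_d$. In particular, for every loopless matroid $M$ we have $\chi_g(M)\leq 2\chi(M)$.
   Context: Coloring game on $M_1,\dots,M_d$ (matroids on a common ground set $E$): two players, Alice and Bob, alternately (Alice moving first) color one uncolored element of $E$ with a color from $\{1,\dots,d\}$, so that at any moment, for each $i$, the set of elements colored with $i$ is independent in $M_i$. The game ends when all of $E$ is colored, or when no uncolored element can be legally colored. Alice wins in the first case, Bob in the second. The matroid coloring game on a single matroid $M$ with $d$ colors is the coloring game on $M_1=\dots=M_d=M$. A matroid is loopless if every one-element set is independent. For a loopless matroid $M$, the game chromatic number $\chi_g(M)$ is the minimum number $d$ of colors for which Alice has a winning strategy in the game on $M$ with $d$ colors, and the chromatic number $\chi(M)$ is the minimum number of independent sets into which the ground set of $M$ can be partitioned. *)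

theory Defs
  imports "HOL-Library.Disjoint_Sets"
begin

locale matroid =
  fixes E :: "'a set" and indep :: "'a set \<Rightarrow> bool"
  assumes finite_ground: "finite E"
    and indep_subset: "indep X \<Longrightarrow> X \<subseteq> E"
    and indep_empty: "indep {}"
    and indep_mono: "indep X \<Longrightarrow> Y \<subseteq> X \<Longrightarrow> indep Y"
    and indep_augment:
      "indep X \<Longrightarrow> indep Y \<Longrightarrow> card X < card Y \<Longrightarrow> \<exists>y\<in>Y - X. indep (insert y X)"

locale loopless_matroid = matroid +
  assumes loopless: "e \<in> E \<Longrightarrow> indep {e}"

text \<open>The move \<open>(e, i)\<close> colors the element \<open>e\<close> with the color \<open>i\<close>. A list of moves is the
  history of a play, oldest move first; Alice makes the moves with even (0-based) index, so it is
  Alice's turn exactly after histories of even length. The matroid \<open>M\<^sub>i\<close> is given by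
  its independence predicate \<open>Ind i\<close>; only the indices in \<open>{1..d}\<close> matter.\<close>

type_synonym 'a move = "'a \<times> nat"

definition colored :: "'a move list \<Rightarrow> 'a set" where
  "colored p = fst ` set p"

definition color_class :: "'a move list \<Rightarrow> nat \<Rightarrow> 'a set" where
  "color_class p i = {e. (e, i) \<in> set p}"

definition legal_move ::
    "'a set \<Rightarrow> nat \<Rightarrow> (nat \<Rightarrow> 'a set \<Rightarrow> bool) \<Rightarrow> 'a move list \<Rightarrow> 'a move \<Rightarrow> bool" where
  "legal_move E d Ind p m \<longleftrightarrow>
     fst m \<in> E - colored p \<and> snd m \<in> {1..d} \<and>
     (\<forall>i\<in>{1..d}. Ind i (color_class (p @ [m]) i))"

definition legal_play ::
    "'a set \<Rightarrow> nat \<Rightarrow> (nat \<Rightarrow> 'a set \<Rightarrow> bool) \<Rightarrow> 'a move list \<Rightarrow> bool" where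
  "legal_play E d Ind p \<longleftrightarrow> (\<forall>k<length p. legal_move E d Ind (take k p) (p ! k))"

text \<open>If all of \<open>E\<close> is colored there is no legal move either, so this covers both ways in which
  the game can end.\<close>

definition game_over ::
    "'a set \<Rightarrow> nat \<Rightarrow> (nat \<Rightarrow> 'a set \<Rightarrow> bool) \<Rightarrow> 'a move list \<Rightarrow> bool" where
  "game_over E d Ind p \<longleftrightarrow> (\<nexists>m. legal_move E d Ind p m)"

text \<open>A strategy for Alice prescribes a move for every history.\<close>

definition follows :: "('a move list \<Rightarrow> 'a move) \<Rightarrow> 'a move list \<Rightarrow> bool" where
  "follows \<sigma> p \<longleftrightarrow> (\<forall>k<length p. even k \<longrightarrow> p ! k = \<sigma> (take k p))"

text \<open>The first conjunct makes \<open>\<sigma>\<close> an actual strategy: without it, a \<open>\<sigma>\<close> prescribing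
  illegal moves would have no finished plays to be tested against.\<close>

definition winning_strategy ::
    "'a set \<Rightarrow> nat \<Rightarrow> (nat \<Rightarrow> 'a set \<Rightarrow> bool) \<Rightarrow> ('a move list \<Rightarrow> 'a move) \<Rightarrow> bool" where
  "winning_strategy E d Ind \<sigma> \<longleftrightarrow>
     (\<forall>p. legal_play E d Ind p \<and> follows \<sigma> p \<and> even (length p) \<and> \<not> game_over E d Ind p
        \<longrightarrow> legal_move E d Ind p (\<sigma> p)) \<and>
     (\<forall>p. legal_play E d Ind p \<and> follows \<sigma> p \<and> game_over E d Ind p \<longrightarrow> colored p = E)"

definition Alice_wins :: "'a set \<Rightarrow> nat \<Rightarrow> (nat \<Rightarrow> 'a set \<Rightarrow> bool) \<Rightarrow> bool" where
  "Alice_wins E d Ind \<longleftrightarrow> (\<exists>\<sigma>. winning_strategy E d Ind \<sigma>)"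

definition game_chromatic_number :: "'a set \<Rightarrow> ('a set \<Rightarrow> bool) \<Rightarrow> nat" where
  "game_chromatic_number E indep = (LEAST d. Alice_wins E d (\<lambda>_. indep))"

definition chromatic_number :: "'a set \<Rightarrow> ('a set \<Rightarrow> bool) \<Rightarrow> nat" where
  "chromatic_number E indep =
     (LEAST k. \<exists>P. partition_on E P \<and> (\<forall>X\<in>P. indep X) \<and> card P = k)"

text \<open>For a loopless matroid both minima are taken over nonempty sets.\<close>

lemma (in loopless_matroid) indep_partition_exists:
  "\<exists>k P. partition_on E P \<and> (\<forall>X\<in>P. indep X) \<and> card P = k"
proof -
  have "partition_on E ((\<lambda>e. {e}) ` E)"
    by (auto simp: partition_on_def disjoint_def)
  then show ?thesis
    using loopless by blast
qed

lemma (in loopless_matroid) Alice_wins_card: "Alice_wins E (card E) (\<lambda>_. indep)"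
proof -
  let ?legal = "legal_move E (card E) (\<lambda>_. indep)"
  let ?play = "legal_play E (card E) (\<lambda>_. indep)"
  have sub: "colored p \<subseteq> E" if "?play p" for p
  proof
    fix e assume "e \<in> colored p"
    then obtain k where "k < length p" "fst (p ! k) = e"
      unfolding colored_def by (metis imageE in_set_conv_nth)
    then show "e \<in> E" using that unfolding legal_play_def legal_move_def by blast
  qed
  have indep_class: "indep (color_class p i)" if "?play p" "i \<in> {1..card E}" for p i
  proof (cases p rule: rev_cases)
    case Nil
    then show ?thesis by (simp add: color_class_def indep_empty)
  next
    case (snoc q m)
    then have "?legal q m"
      using that(1) unfolding legal_play_def by (metis append_eq_conv_conj length_append_singleton lessI nth_append_length)
    then show ?thesis using that(2) snoc unfolding legal_move_def by blast
  qed
  have ex: "\<exists>m. ?legal p m" if play: "?play p" and ne: "colored p \<noteq> E" for p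
  proof -
    obtain e where e: "e \<in> E" "e \<notin> colored p" using sub[OF play] ne by blast
    have dist: "distinct (map fst p)"
      unfolding distinct_conv_nth
    proof (intro allI impI)
      have *: "fst (p ! i) \<noteq> fst (p ! j)" if "i < j" "j < length p" for i j
      proof
        assume eq: "fst (p ! i) = fst (p ! j)"
        have "p ! i \<in> set (take j p)" using that by (auto simp: in_set_conv_nth)
        then have "fst (p ! j) \<in> colored (take j p)"
          unfolding colored_def by (metis eq imageI)
        then show False using play that unfolding legal_play_def legal_move_def by blast
      qed
      fix i j assume "i < length (map fst p)" "j < length (map fst p)" "i \<noteq> j"
      then show "map fst p ! i \<noteq> map fst p ! j" using *[of i j] *[of j i] by (cases "i < j") auto
    qed
    have "length p = card (colored p)"
      using distinct_card[OF dist] by (simp add: colored_def)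
    moreover have "card (colored p) < card E"
      using sub[OF play] ne finite_ground by (meson psubsetI psubset_card_mono)
    ultimately have "card (snd ` set p) < card {1..card E}"
      by (metis card_atLeastAtMost card_length diff_Suc_1 le_less_trans length_map list.set_map)
    then obtain i where i: "i \<in> {1..card E}" "i \<notin> snd ` set p"
      by (metis List.finite_set card_mono finite_imageI leD subsetI)
    have "?legal p (e, i)"
      unfolding legal_move_def
    proof (intro conjI ballI)
      show "fst (e, i) \<in> E - colored p" using e by simp
      show "snd (e, i) \<in> {1..card E}" using i by simp
      fix j assume j: "j \<in> {1..card E}"
      show "indep (color_class (p @ [(e, i)]) j)"
      proof (cases "j = i")
        case True
        then have "color_class (p @ [(e, i)]) j = {e}"
          using i(2) by (force simp: color_class_def)
        then show ?thesis using loopless[OF e(1)] by simp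
      next
        case False
        then have "color_class (p @ [(e, i)]) j = color_class p j"
          by (auto simp: color_class_def)
        then show ?thesis using indep_class[OF play j] by simp
      qed
    qed
    then show ?thesis by blast
  qed
  have "winning_strategy E (card E) (\<lambda>_. indep) (\<lambda>p. SOME m. ?legal p m)"
    unfolding winning_strategy_def game_over_def using ex by (metis someI)
  then show ?thesis unfolding Alice_wins_def by blast
qed

end

theory Submission
  imports Defs
begin

text \<open>
  Alice keeps, for every color \<open>i\<close>, a set \<open>V i\<close> of elements that are \<^emph>\<open>reserved\<close> for \<open>i\<close>: the
  elements colored \<open>i\<close> together with the uncolored elements of \<open>V i\<close> are independent in the
  \<open>i\<close>-th matroid (\<open>reservation\<close>). An element may always be colored with a color for which it is
  reserved, and such a move keeps all reservations of the other uncolored elements intact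
  (\<open>reserved_move\<close>). The invariant is that, when Bob is to move, every uncolored element is
  reserved for at least two colors.

  If Bob colors \<open>x\<close> with \<open>j\<close>, then augmenting the new color class from the old set of elements
  colored or reserved for \<open>j\<close> shows that at most one element \<open>y\<close> has to give up its
  reservation for \<open>j\<close> (\<open>matroid.exchange_one\<close>). This is where two reservations are needed: \<open>y\<close>
  still has another one, and Alice answers by coloring \<open>y\<close> accordingly, so that all remaining
  uncolored elements have two reservations again. If Bob has done no damage, Alice colors any
  element with one of its reserved colors. As an uncolored element always has a reserved color,
  the game cannot get stuck.

  The bound on the game chromatic number follows by using every block of an optimal partition
  into independent sets as the reservation of two colors.
\<close>

section \<open>Augmentation and exchange in a matroid\<close>

lemma (in matroid) extend_to_card:
  assumes "indep X" "indep Y" "card X \<le> card Y"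
  shows "\<exists>Z. X \<subseteq> Z \<and> Z \<subseteq> X \<union> Y \<and> indep Z \<and> card Z = card Y"
  using assms
proof (induction "card Y - card X" arbitrary: X)
  case 0
  then have "card X = card Y" by simp
  then show ?case using 0 by blast
next
  case (Suc n)
  then have "card X < card Y" by linarith
  then obtain y where y: "y \<in> Y - X" "indep (insert y X)"
    using indep_augment[OF Suc.prems(1,2)] by blast
  have "finite X"
    using Suc.prems(1) indep_subset finite_ground finite_subset by blast
  then have "card (insert y X) = Suc (card X)"
    using y(1) by simp
  then have "\<exists>Z. insert y X \<subseteq> Z \<and> Z \<subseteq> insert y X \<union> Y \<and> indep Z \<and> card Z = card Y"
    using Suc.hyps(2) \<open>card X < card Y\<close> by (intro Suc.hyps(1) y(2) Suc.prems(2)) linarith+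
  then show ?case using y(1) by blast
qed

text \<open>If \<open>x\<close> is outside \<open>C \<union> W\<close>, then \<open>insert x C\<close> can be extended inside \<open>insert x (C \<union> W)\<close> to the
  size of \<open>C \<union> W\<close>, and the extension omits a single element.\<close>

lemma (in matroid) exchange_one:
  assumes "indep (insert x C)" "indep (C \<union> W)"
  shows "\<exists>y. indep (insert x C \<union> (W - {y}))"
proof (cases "x \<in> C \<union> W \<or> W \<subseteq> C")
  case True
  then have "insert x C \<union> (W - {x}) \<subseteq> C \<union> W \<or> insert x C \<union> (W - {x}) \<subseteq> insert x C"
    by auto
  then show ?thesis using assms indep_mono by blast
next
  case False
  have fin: "finite (C \<union> W)"
    using assms(2) indep_subset finite_ground finite_subset by blast
  have "card C < card (C \<union> W)"
    using False fin by (intro psubset_card_mono) auto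
  then have "card (insert x C) \<le> card (C \<union> W)"
    using False fin by simp
  then obtain Z where Z: "insert x C \<subseteq> Z" "Z \<subseteq> insert x (C \<union> W)" "indep Z"
      "card Z = card (C \<union> W)"
    using extend_to_card[OF assms] by auto
  have "card (insert x (C \<union> W) - Z) = 1"
    using Z fin False by (subst card_Diff_subset) (auto intro: finite_subset)
  then obtain y where "insert x (C \<union> W) - Z = {y}"
    by (meson card_1_singletonE)
  then have "insert x C \<union> (W - {y}) \<subseteq> Z"
    using Z(1) by auto
  then show ?thesis using Z(3) indep_mono by blast
qed

section \<open>Winning by an invariant\<close>

lemma legal_play_snoc:
  "legal_play E d Ind (p @ [m]) \<longleftrightarrow> legal_play E d Ind p \<and> legal_move E d Ind p m"
  by (auto simp: legal_play_def less_Suc_eq nth_append)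

lemma follows_snoc:
  "follows \<sigma> (p @ [m]) \<longleftrightarrow> follows \<sigma> p \<and> (even (length p) \<longrightarrow> m = \<sigma> p)"
  by (auto simp: follows_def less_Suc_eq nth_append)

text \<open>Here \<open>A\<close> is an invariant of the positions with Alice to move and \<open>B\<close> of those with Bob to move.
  Alice's strategy is to choose any legal move that leads to \<open>B\<close>.\<close>

lemma Alice_wins_invariant:
  assumes start: "A []"
    and Alice_move: "\<And>p. A p \<Longrightarrow> E - colored p \<noteq> {} \<Longrightarrow> \<exists>m. legal_move E d Ind p m \<and> B (p @ [m])"
    and Bob_move: "\<And>p m. B p \<Longrightarrow> legal_move E d Ind p m \<Longrightarrow> A (p @ [m])"
    and Bob_not_stuck: "\<And>p. B p \<Longrightarrow> E - colored p \<noteq> {} \<Longrightarrow> \<exists>m. legal_move E d Ind p m"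
  shows "Alice_wins E d Ind"
proof -
  define \<sigma> where "\<sigma> p = (SOME m. legal_move E d Ind p m \<and> B (p @ [m]))" for p
  have \<sigma>: "legal_move E d Ind p (\<sigma> p) \<and> B (p @ [\<sigma> p])" if "A p" "E - colored p \<noteq> {}" for p
    unfolding \<sigma>_def using Alice_move[OF that] by (rule someI_ex)
  have uncolored: "E - colored p \<noteq> {}" if "legal_move E d Ind p m" for p m
    using that by (auto simp: legal_move_def)
  have inv: "colored p \<subseteq> E \<and> (if even (length p) then A p else B p)"
    if "legal_play E d Ind p" "follows \<sigma> p" for p
    using that
  proof (induction p rule: rev_induct)
    case Nil
    then show ?case using start by (simp add: colored_def)
  next
    case (snoc m p)
    have prefix: "legal_play E d Ind p" "follows \<sigma> p" and legal: "legal_move E d Ind p m"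
      and "even (length p) \<longrightarrow> m = \<sigma> p"
      using snoc.prems by (simp_all add: legal_play_snoc follows_snoc)
    moreover have "colored (p @ [m]) \<subseteq> E"
      using snoc.IH[OF prefix] legal by (auto simp: colored_def legal_move_def)
    ultimately show ?case
      using snoc.IH[OF prefix] \<sigma>[of p] uncolored[OF legal] Bob_move[of p m] legal by auto
  qed
  have "winning_strategy E d Ind \<sigma>"
    unfolding winning_strategy_def
  proof (intro conjI allI impI; elim conjE)
    fix p assume "legal_play E d Ind p" "follows \<sigma> p" "even (length p)" "\<not> game_over E d Ind p"
    then show "legal_move E d Ind p (\<sigma> p)"
      using inv[of p] \<sigma>[of p] uncolored[of p] by (auto simp: game_over_def)
  next
    fix p assume p: "legal_play E d Ind p" "follows \<sigma> p" and over: "game_over E d Ind p"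
    have "E - colored p = {}"
    proof (cases "even (length p)")
      case True
      then show ?thesis using inv[OF p] Alice_move[of p] over by (auto simp: game_over_def)
    next
      case False
      then show ?thesis using inv[OF p] Bob_not_stuck[of p] over by (auto simp: game_over_def)
    qed
    then show "colored p = E" using inv[OF p] by auto
  qed
  then show ?thesis unfolding Alice_wins_def by blast
qed

section \<open>Reserved colors\<close>

definition reservation ::
    "nat \<Rightarrow> (nat \<Rightarrow> 'a set \<Rightarrow> bool) \<Rightarrow> 'a move list \<Rightarrow> (nat \<Rightarrow> 'a set) \<Rightarrow> bool" where
  "reservation d Ind p V \<longleftrightarrow> (\<forall>i\<in>{1..d}. Ind i (color_class p i \<union> (V i - colored p)))"

definition reserved_colors :: "nat \<Rightarrow> (nat \<Rightarrow> 'a set) \<Rightarrow> 'a \<Rightarrow> nat set" where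
  "reserved_colors d V e = {i \<in> {1..d}. e \<in> V i}"

lemma finite_reserved_colors: "finite (reserved_colors d V e)"
  by (simp add: reserved_colors_def)

lemma colored_snoc: "colored (p @ [(e, i)]) = insert e (colored p)"
  by (simp add: colored_def)

lemma color_class_snoc:
  "color_class (p @ [(e, i)]) j = (if j = i then insert e (color_class p j) else color_class p j)"
  by (auto simp: color_class_def)

text \<open>The move only turns a reserved element into a colored one, so for each color the set of
  elements colored or reserved for it does not grow.\<close>

lemma reserved_move:
  assumes matroids: "\<forall>i\<in>{1..d}. matroid E (Ind i)"
    and res: "reservation d Ind p V"
    and e: "e \<in> E - colored p" and k: "k \<in> reserved_colors d V e"
  shows "legal_move E d Ind p (e, k)" "reservation d Ind (p @ [(e, k)]) V"
proof -
  have new: "Ind i (color_class (p @ [(e, k)]) i \<union> (V i - colored (p @ [(e, k)])))"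
    if i: "i \<in> {1..d}" for i
  proof -
    have "Ind i (color_class p i \<union> (V i - colored p))"
      using i res unfolding reservation_def by blast
    moreover have "color_class (p @ [(e, k)]) i \<union> (V i - colored (p @ [(e, k)]))
        \<subseteq> color_class p i \<union> (V i - colored p)"
      using e k by (auto simp: color_class_snoc colored_snoc reserved_colors_def)
    ultimately show ?thesis
      by (rule matroid.indep_mono[OF bspec[OF matroids i]])
  qed
  then show "reservation d Ind (p @ [(e, k)]) V"
    unfolding reservation_def by blast
  have "Ind i (color_class (p @ [(e, k)]) i)" if "i \<in> {1..d}" for i
    by (rule matroid.indep_mono[OF bspec[OF matroids that] new[OF that] Un_upper1])
  then show "legal_move E d Ind p (e, k)"
    using e k by (simp add: legal_move_def reserved_colors_def)
qed

text \<open>After an arbitrary legal move, only the reservation for the color just used can be violated,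
  and cancelling it for a single element suffices.\<close>

lemma reservation_after_legal_move:
  assumes matroids: "\<forall>i\<in>{1..d}. matroid E (Ind i)"
    and res: "reservation d Ind p V" and legal: "legal_move E d Ind p (x, j)"
  shows "\<exists>y. reservation d Ind (p @ [(x, j)]) (V(j := V j - {y}))"
proof -
  have j: "j \<in> {1..d}" and "Ind j (color_class (p @ [(x, j)]) j)"
    using legal by (auto simp: legal_move_def)
  then have "Ind j (insert x (color_class p j))"
      "Ind j (color_class p j \<union> (V j - colored p))"
    using res by (auto simp: color_class_snoc reservation_def)
  then obtain y where y: "Ind j (insert x (color_class p j) \<union> (V j - colored p - {y}))"
    using matroid.exchange_one[OF bspec[OF matroids j]] by blast
  have "reservation d Ind (p @ [(x, j)]) (V(j := V j - {y}))"
    unfolding reservation_def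
  proof
    fix i assume i: "i \<in> {1..d}"
    have mono: "Ind i Y" if "Ind i X" "Y \<subseteq> X" for X Y
      by (rule matroid.indep_mono[OF bspec[OF matroids i] that])
    show "Ind i (color_class (p @ [(x, j)]) i
        \<union> ((V(j := V j - {y})) i - colored (p @ [(x, j)])))"
    proof (cases "i = j")
      case True
      show ?thesis
        by (rule mono[of "insert x (color_class p j) \<union> (V j - colored p - {y})"])
          (use True y in \<open>auto simp: color_class_snoc colored_snoc\<close>)
    next
      case False
      show ?thesis
        by (rule mono[of "color_class p i \<union> (V i - colored p)"])
          (use False res i in \<open>auto simp: color_class_snoc colored_snoc reservation_def\<close>)
    qed
  qed
  then show ?thesis ..
qed

lemma card_reserved_colors_cancel:
  assumes "2 \<le> card (reserved_colors d V e)"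
  shows "(if e = y then 1 else 2) \<le> card (reserved_colors d (V(j := V j - {y})) e)"
proof (cases "e = y")
  case True
  then have "reserved_colors d (V(j := V j - {y})) e = reserved_colors d V e - {j}"
    by (auto simp: reserved_colors_def)
  moreover have "card (reserved_colors d V e) - 1 \<le> card (reserved_colors d V e - {j})"
    using finite_reserved_colors[of d V e] by (simp add: card_Diff_singleton_if)
  ultimately show ?thesis using assms True by simp
next
  case False
  then have "reserved_colors d (V(j := V j - {y})) e = reserved_colors d V e"
    by (auto simp: reserved_colors_def)
  then show ?thesis using assms False by simp
qed

text \<open>The invariant for the positions with Alice to move allows one element \<open>y\<close> to be down to a
  single reservation. As \<open>y\<close> need not be an uncolored element, this includes the positions in which
  no reservation was lost.\<close>

proposition Alice_wins_if_covered_twice: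
  assumes matroids: "\<forall>i\<in>{1..d}. matroid E (Ind i)"
    and twice: "\<forall>e\<in>E. 2 \<le> card (reserved_colors d V e)"
    and indep: "\<forall>i\<in>{1..d}. Ind i (V i)"
  shows "Alice_wins E d Ind"
proof (rule Alice_wins_invariant)
  let ?A = "\<lambda>p. \<exists>V y. reservation d Ind p V \<and>
    (\<forall>e\<in>E - colored p. (if e = y then 1 else 2) \<le> card (reserved_colors d V e))"
  let ?B = "\<lambda>p. \<exists>V. reservation d Ind p V \<and>
    (\<forall>e\<in>E - colored p. 2 \<le> card (reserved_colors d V e))"
  show "?A []"
    \<comment> \<open>Nothing is damaged yet, so \<open>y\<close> is arbitrary.\<close>
  proof (intro exI conjI)
    show "reservation d Ind [] V"
      using indep by (simp add: reservation_def color_class_def colored_def)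
    show "\<forall>e\<in>E - colored []. (if e = undefined then 1 else 2) \<le> card (reserved_colors d V e)"
      using twice by force
  qed
  show "\<exists>m. legal_move E d Ind p m \<and> ?B (p @ [m])" if A: "?A p" and ne: "E - colored p \<noteq> {}" for p
  proof -
    obtain V y where res: "reservation d Ind p V"
      and card: "\<forall>e\<in>E - colored p. (if e = y then 1 else 2) \<le> card (reserved_colors d V e)"
      using A by blast
    \<comment> \<open>Alice takes \<open>y\<close> as long as it is uncolored: coloring it removes the only exception.\<close>
    obtain e where e: "e \<in> E - colored p" and y: "y \<in> E - colored p \<longrightarrow> e = y"
      using ne by blast
    have "0 < card (reserved_colors d V e)"
      using bspec[OF card e] by (simp split: if_splits)
    then obtain k where k: "k \<in> reserved_colors d V e"
      by (metis card_gt_0_iff ex_in_conv)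
    have "\<forall>e'\<in>E - colored (p @ [(e, k)]). 2 \<le> card (reserved_colors d V e')"
      using card y by (auto simp: colored_snoc split: if_splits)
    then show ?thesis
      using reserved_move[OF matroids res e k] by blast
  qed
  show "?A (p @ [m])" if B: "?B p" and legal: "legal_move E d Ind p m" for p m
  proof -
    obtain V where res: "reservation d Ind p V"
      and card: "\<forall>e\<in>E - colored p. 2 \<le> card (reserved_colors d V e)"
      using B by blast
    obtain x j where m: "m = (x, j)" by (cases m)
    obtain y where "reservation d Ind (p @ [m]) (V(j := V j - {y}))"
      using reservation_after_legal_move[OF matroids res] legal unfolding m by blast
    moreover have "\<forall>e\<in>E - colored (p @ [m]).
        (if e = y then 1 else 2) \<le> card (reserved_colors d (V(j := V j - {y})) e)"
      using card by (intro ballI card_reserved_colors_cancel) (simp add: m colored_snoc)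
    ultimately show ?thesis by blast
  qed
  show "\<exists>m. legal_move E d Ind p m" if B: "?B p" and ne: "E - colored p \<noteq> {}" for p
  proof -
    obtain V e where res: "reservation d Ind p V" and e: "e \<in> E - colored p"
      and card: "2 \<le> card (reserved_colors d V e)"
      using B ne by blast
    then obtain k where "k \<in> reserved_colors d V e"
      by (metis card.empty ex_in_conv not_numeral_le_zero)
    then show ?thesis using reserved_move(1)[OF matroids res e] by blast
  qed
qed

section \<open>Doubling a partition into independent sets\<close>

text \<open>With the blocks numbered from \<open>0\<close>, block \<open>j\<close> is reserved for the colors \<open>2 * j + 1\<close> and
  \<open>2 * j + 2\<close>, so that color \<open>i\<close> belongs to block \<open>(i - 1) div 2\<close>.\<close>

lemma (in matroid) Alice_wins_twice_partition:
  assumes P: "partition_on E P" "\<forall>X\<in>P. indep X"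
  shows "Alice_wins E (2 * card P) (\<lambda>_. indep)"
proof -
  have "finite P" using finite_elements[OF finite_ground P(1)] .
  then obtain h where h: "bij_betw h {0..<card P} P"
    using ex_bij_betw_nat_finite by blast
  define V where "V i = h ((i - 1) div 2)" for i :: nat
  have mem: "V i \<in> P" if "i \<in> {1..2 * card P}" for i
  proof -
    have "(i - 1) div 2 \<in> {0..<card P}" using that by auto
    then show ?thesis unfolding V_def using h by (rule bij_betwE[rule_format, rotated])
  qed
  have "2 \<le> card (reserved_colors (2 * card P) V e)" if e: "e \<in> E" for e
  proof -
    obtain X where "X \<in> P" "e \<in> X" using partition_onD1[OF P(1)] e by blast
    then obtain j where j: "j < card P" "e \<in> h j"
      using bij_betw_imp_surj_on[OF h] by (metis atLeastLessThan_iff imageE)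
    have "{2 * j + 1, 2 * j + 2} \<subseteq> reserved_colors (2 * card P) V e"
      using j by (auto simp: reserved_colors_def V_def)
    from card_mono[OF finite_reserved_colors this] show ?thesis by simp
  qed
  moreover have "matroid E indep" by unfold_locales
  ultimately show ?thesis
    using mem P(2) by (intro Alice_wins_if_covered_twice[where V = V]) auto
qed

theorem theorem3p1:
  shows "(\<forall>(E :: 'a set) (d :: nat) (Ind :: nat \<Rightarrow> 'a set \<Rightarrow> bool) (V :: nat \<Rightarrow> 'a set).
            finite E \<and>
            (\<forall>i\<in>{1..d}. matroid E (Ind i)) \<and>
            (\<forall>i\<in>{1..d}. V i \<subseteq> E) \<and>
            (\<forall>e\<in>E. card {i \<in> {1..d}. e \<in> V i} = 2) \<and>
            (\<forall>i\<in>{1..d}. Ind i (V i))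
            \<longrightarrow> Alice_wins E d Ind) \<and>
         (\<forall>(E :: 'a set) (indep :: 'a set \<Rightarrow> bool).
            loopless_matroid E indep
            \<longrightarrow> game_chromatic_number E indep \<le> 2 * chromatic_number E indep)"
proof (intro conjI allI impI; (elim conjE)?)
  fix E :: "'a set" and d :: nat and Ind :: "nat \<Rightarrow> 'a set \<Rightarrow> bool" and V :: "nat \<Rightarrow> 'a set"
  assume "\<forall>i\<in>{1..d}. matroid E (Ind i)" "\<forall>e\<in>E. card {i \<in> {1..d}. e \<in> V i} = 2"
    "\<forall>i\<in>{1..d}. Ind i (V i)"
  then show "Alice_wins E d Ind"
    by (intro Alice_wins_if_covered_twice[where V = V]) (simp_all add: reserved_colors_def)
next
  fix E :: "'a set" and indep :: "'a set \<Rightarrow> bool"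
  assume "loopless_matroid E indep"
  then interpret loopless_matroid E indep .
  have "\<exists>P. partition_on E P \<and> (\<forall>X\<in>P. indep X) \<and> card P = chromatic_number E indep"
    unfolding chromatic_number_def using indep_partition_exists by (rule LeastI_ex)
  then have "Alice_wins E (2 * chromatic_number E indep) (\<lambda>_. indep)"
    using Alice_wins_twice_partition by metis
  then show "game_chromatic_number E indep \<le> 2 * chromatic_number E indep"
    unfolding game_chromatic_number_def by (rule Least_le)
qed

end
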